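(* Let $A(x;p,q;v):=\sum_{i\ge 1}A_i(x;p,q)\,v^{i-1}$, where $A_i(x;p,q):=\sum_{n\ge 1}x^n\sum_{w\in\mathcal{M}_{n,i}}p^{\mathrm{sper}(w)}q^{\mathrm{area}(w)}$. Then the generating function $A(x;p,q;v)$ satisfies the functional equation $$A(x;p,q;v)= p^2qx + \frac{pqx}{1-qv}A(x;p,q;1) + \left(p^2q^2xv- \frac{pqx}{1-qv}\right)A(x;p,q;qv).$$
   Context: A Motzkin word of length $n\ge 1$ is a word $w=w_1\cdots w_n$ over the positive integers such that $w_1=1$, and $1\le w_k\le w_{k-1}+1$ and $w_{k-1}\ne w_k$ for $k=2,\dots,n$. $\mathcal{M}_{n,i}$ is the set of Motzkin words of length $n$ whose last symbol is $i$. To $w$ one associates the polyomino $P(w)$ (Motzkin polyomino) with $n$ columns, all bottom-justified, whose $i$-th column consists of $w_i$ unit cells. $\mathrm{area}(w)$ is the number of cells of $P(w)$, i.e. $w_1+\cdots+w_n$. The perimeter of $P(w)$ is the number of (unit) cell borders that do not touch another cell of $P(w)$, and the semiperimeter $\mathrm{sper}(w)$ is half of the perimeter. Identities are between formal power series (in $x$, with $1/(1-qv)$ expanded as a geometric series). *)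

theory Defs
  imports "HOL-Computational_Algebra.Computational_Algebra"
begin

text \<open>
  Words are lists; positions are counted from 0.  Positivity of all letters follows from
  the two conditions on the letters.
\<close>

definition motzkin_word :: "nat list \<Rightarrow> bool" where
  "motzkin_word w \<longleftrightarrow>
     length w \<ge> 1 \<and> w ! 0 = 1 \<and>
     (\<forall>k. 1 \<le> k \<and> k < length w \<longrightarrow>
        1 \<le> w ! k \<and> w ! k \<le> w ! (k - 1) + 1 \<and> w ! (k - 1) \<noteq> w ! k)"

definition motzkin_words :: "nat \<Rightarrow> nat \<Rightarrow> nat list set" where
  "motzkin_words n i = {w. motzkin_word w \<and> length w = n \<and> last w = i}"

text \<open>
  A cell is a unit square of the integer grid, given by its column and its height.
\<close>

definition polyomino :: "nat list \<Rightarrow> (int \<times> int) set" where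
  "polyomino w = {(int k, int h) | k h. k < length w \<and> h < w ! k}"

definition neighbours :: "int \<times> int \<Rightarrow> int \<times> int \<Rightarrow> bool" where
  "neighbours c d \<longleftrightarrow> \<bar>fst c - fst d\<bar> + \<bar>snd c - snd d\<bar> = 1"

text \<open>
  A border of a cell \<open>c\<close> is represented by the pair of \<open>c\<close> and the grid square \<open>d\<close> on the
  other side of that border.
\<close>

definition perimeter :: "(int \<times> int) set \<Rightarrow> nat" where
  "perimeter P = card {(c, d). c \<in> P \<and> d \<notin> P \<and> neighbours c d}"

definition area :: "nat list \<Rightarrow> nat" where
  "area w = card (polyomino w)"

text \<open>
  The division is exact: every maximal run of cells in a row or in a column contributes
  exactly two borders to the perimeter.
\<close>

definition sper :: "nat list \<Rightarrow> nat" where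
  "sper w = perimeter (polyomino w) div 2"

text \<open>
  The generating functions are power series in \<open>x\<close> (which is \<open>fps_X\<close>); the parameters
  \<open>p\<close>, \<open>q\<close>, \<open>v\<close> are arbitrary elements of the coefficient ring, so that \<open>A\<close> can be
  formed at \<open>v\<close>, at \<open>1\<close> and at \<open>q * v\<close>.  The coefficient of \<open>x^0\<close> vanishes because
  there is no Motzkin word of length 0.  The infinite sum over \<open>i\<close> is taken in the
  topology of formal power series in \<open>x\<close>.
\<close>

definition A_coeff :: "'a::comm_ring_1 \<Rightarrow> 'a \<Rightarrow> nat \<Rightarrow> 'a fps" where
  "A_coeff p q i = Abs_fps (\<lambda>n. \<Sum>w\<in>motzkin_words n i. p ^ sper w * q ^ area w)"

definition A :: "'a::comm_ring_1 \<Rightarrow> 'a \<Rightarrow> 'a \<Rightarrow> 'a fps" where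
  "A p q v = (\<Sum>i. A_coeff p q (Suc i) * fps_const (v ^ i))"

text \<open>
  The indeterminates \<open>p\<close>, \<open>q\<close>, \<open>v\<close> in the ring \<open>Z[p,q][[v]]\<close>, where the inner polynomial
  variable is \<open>p\<close> and the outer one is \<open>q\<close>.
\<close>

definition indet_p :: "int poly poly fps" where
  "indet_p = fps_const [: [:0, 1:] :]"

definition indet_q :: "int poly poly fps" where
  "indet_q = fps_const [:0, 1:]"

definition indet_v :: "int poly poly fps" where
  "indet_v = fps_X"

text \<open>
  The series expansion of \<open>1 / (1 - u)\<close>, with the sum taken in the topology of formal
  power series (in the theorem: series in \<open>v\<close>, at \<open>u = q * v\<close>).
\<close>

definition geometric_series :: "'a::comm_ring_1 fps \<Rightarrow> 'a fps" where
  "geometric_series u = (\<Sum>k. u ^ k)"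

text \<open>Both infinite sums converge where they are used.\<close>

lemma summable_fpsI:
  fixes f :: "nat \<Rightarrow> 'a::comm_ring_1 fps"
  assumes "\<And>i n. n < i \<Longrightarrow> fps_nth (f i) n = 0"
  shows "summable f"
proof -
  have "f sums Abs_fps (\<lambda>n. \<Sum>i\<le>n. fps_nth (f i) n)"
    unfolding sums_def
  proof (rule tendsto_fpsI)
    fix n
    show "\<forall>\<^sub>F N in sequentially.
        fps_nth (\<Sum>i<N. f i) n = fps_nth (Abs_fps (\<lambda>n. \<Sum>i\<le>n. fps_nth (f i) n)) n"
      using eventually_gt_at_top[of n]
    proof eventually_elim
      case (elim N)
      have "(\<Sum>i<N. fps_nth (f i) n) = (\<Sum>i\<le>n. fps_nth (f i) n)"
        by (rule sum.mono_neutral_right) (use elim assms in auto)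
      then show ?case by (simp add: fps_sum_nth)
    qed
  qed
  then show ?thesis by (rule sums_summable)
qed

lemma motzkin_word_nth_le:
  assumes "motzkin_word w" "k < length w"
  shows "w ! k \<le> Suc k"
  using assms(2)
proof (induction k)
  case 0
  then show ?case using assms(1) by (simp add: motzkin_word_def)
next
  case (Suc k)
  have "w ! Suc k \<le> w ! k + 1"
    using assms(1) Suc.prems unfolding motzkin_word_def
    by (metis diff_Suc_1 le_add1 plus_1_eq_Suc)
  then show ?case using Suc by simp
qed

lemma motzkin_words_empty:
  assumes "n < i"
  shows "motzkin_words n i = {}"
proof -
  have "last w \<le> length w" if "motzkin_word w" for w
  proof -
    have "w \<noteq> []" using that by (auto simp: motzkin_word_def)
    then show ?thesis
      using motzkin_word_nth_le[OF that, of "length w - 1"] by (simp add: last_conv_nth)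
  qed
  then show ?thesis using assms by (force simp: motzkin_words_def)
qed

lemma summable_A: "summable (\<lambda>i. A_coeff p q (Suc i) * fps_const (v ^ i))"
  by (rule summable_fpsI) (simp add: A_coeff_def motzkin_words_empty)

lemma summable_geometric_series:
  assumes "fps_nth u 0 = 0"
  shows "summable (\<lambda>k. (u :: 'a::comm_ring_1 fps) ^ k)"
  by (rule summable_fpsI) (simp add: assms startsby_zero_power_prefix)

end

theory Submission
  imports Defs "HOL-Library.Product_Plus"
begin

text \<open>
  A Motzkin word of length at least two arises in exactly one way by appending a letter to
  a shorter one, and the letters allowed after a last letter \<open>i\<close> are \<open>i + 1\<close> and
  \<open>1, \<dots>, i - 1\<close>.  Appending \<open>j\<close> adds \<open>j\<close> to the area.  It adds one to the
  semiperimeter for the new column, plus one for each unit by which \<open>j\<close> exceeds \<open>i\<close>.  A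
  word with last letter \<open>i\<close>, whose weight in \<open>A p q v\<close> is
  \<open>p ^ sper w * q ^ area w * v ^ (i - 1)\<close>, therefore contributes to the words one letter
  longer its weight at \<open>v = 1\<close> times
  \[ p^2 q^{i+1} v^i + \sum_{j=1}^{i-1} p q^j v^{j-1}
     = p^2 q^2 v (q v)^{i-1} + \frac{p q}{1 - q v} (1 - (q v)^{i-1}) . \]
  The powers \<open>(q * v) ^ (i - 1)\<close> turn the sum over all words into \<open>A p q (q * v)\<close>, and the
  constant part turns it into \<open>A p q 1\<close>.  The word of length one gives the term
  \<open>p\<^sup>2 * q * x\<close>.

  The effect on the semiperimeter (\<open>sper_snoc\<close>) rests on a fact about arbitrary finite sets
  of cells: as many cells have a free left side as have a free right side, and likewise for
  bottom and top.  So the semiperimeter counts left and bottom borders only, and these are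
  not affected by columns further to the right.
\<close>

section \<open>Semiperimeter and area\<close>

text \<open>
  The cells of \<open>P\<close> with their neighbour in direction \<open>e\<close> in \<open>P\<close> are carried by the
  translation by \<open>e\<close> onto those with their neighbour in direction \<open>- e\<close> in \<open>P\<close>; in a finite
  set the complements are then equinumerous as well.
\<close>

lemma card_free_sides_opposite:
  fixes P :: "'a::ab_group_add set"
  assumes "finite P"
  shows "card {c \<in> P. c + e \<notin> P} = card {c \<in> P. c - e \<notin> P}"
proof -
  let ?R = "{c \<in> P. c + e \<in> P}" and ?L = "{c \<in> P. c - e \<in> P}"
  have "bij_betw (\<lambda>c. c + e) ?R ?L"
    by (rule bij_betw_byWitness[where f' = "\<lambda>c. c - e"]) auto
  then have "card ?R = card ?L" by (rule bij_betw_same_card)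
  moreover have "{c \<in> P. c + e \<notin> P} = P - ?R" "{c \<in> P. c - e \<notin> P} = P - ?L"
    by auto
  ultimately show ?thesis
    using assms by (simp add: card_Diff_subset)
qed

lemma perimeter_eq_left_bottom:
  assumes "finite P"
  shows "perimeter P =
    2 * (card {c \<in> P. c - (1, 0) \<notin> P} + card {c \<in> P. c - (0, 1) \<notin> P})"
proof -
  define D :: "(int \<times> int) set" where "D = {(1, 0), (-1, 0), (0, 1), (0, -1)}"
  have nb: "neighbours c d \<longleftrightarrow> d - c \<in> D" for c d
    by (cases c; cases d) (auto simp: neighbours_def D_def)
  let ?S = "SIGMA e:D. {c \<in> P. c + e \<notin> P}"
  have "bij_betw (\<lambda>(e, c). (c, c + e)) ?S {(c, d). c \<in> P \<and> d \<notin> P \<and> neighbours c d}"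
    by (rule bij_betw_byWitness[where f' = "\<lambda>(c, d). (d - c, c)"]) (auto simp: nb)
  then have "perimeter P = card ?S"
    unfolding perimeter_def by (simp add: bij_betw_same_card)
  also have "\<dots> = (\<Sum>e\<in>D. card {c \<in> P. c + e \<notin> P})"
    using assms by (simp add: D_def)
  also have "\<dots> = card {c \<in> P. c + (1, 0) \<notin> P} + card {c \<in> P. c - (1, 0) \<notin> P}
      + card {c \<in> P. c + (0, 1) \<notin> P} + card {c \<in> P. c - (0, 1) \<notin> P}"
  proof -
    have minus: "c + (-1, 0) = c - (1, 0)" "c + (0, -1) = c - (0, 1)" for c :: "int \<times> int"
      by (cases c; simp)+
    show ?thesis by (simp add: D_def minus)
  qed
  finally show ?thesis
    by (simp add: card_free_sides_opposite[OF assms, of "(1, 0)"]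
        card_free_sides_opposite[OF assms, of "(0, 1)"])
qed

lemma mem_polyomino:
  "(k, h) \<in> polyomino w \<longleftrightarrow>
    0 \<le> k \<and> k < int (length w) \<and> 0 \<le> h \<and> h < int (w ! nat k)"
proof
  assume "(k, h) \<in> polyomino w"
  then show "0 \<le> k \<and> k < int (length w) \<and> 0 \<le> h \<and> h < int (w ! nat k)"
    by (auto simp: polyomino_def)
next
  assume "0 \<le> k \<and> k < int (length w) \<and> 0 \<le> h \<and> h < int (w ! nat k)"
  then show "(k, h) \<in> polyomino w"
    unfolding polyomino_def
    by (intro CollectI exI[of _ "nat k"] exI[of _ "nat h"]) auto
qed

lemma polyomino_snoc:
  "polyomino (w @ [j]) = polyomino w \<union> {int (length w)} \<times> {0..<int j}"
proof (rule set_eqI, clarify)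
  fix k h
  show "(k, h) \<in> polyomino (w @ [j]) \<longleftrightarrow>
      (k, h) \<in> polyomino w \<union> {int (length w)} \<times> {0..<int j}"
    by (cases "k < int (length w)") (auto simp: mem_polyomino nth_append nat_less_iff)
qed

lemma polyomino_less_length: "(k, h) \<in> polyomino w \<Longrightarrow> k < int (length w)"
  by (auto simp: polyomino_def)

lemma finite_polyomino: "finite (polyomino w)"
proof (induction w rule: rev_induct)
  case Nil
  then show ?case by (simp add: polyomino_def)
qed (simp add: polyomino_snoc)

lemma area_snoc: "area (w @ [j]) = area w + j"
  unfolding area_def polyomino_snoc
  by (subst card_Un_disjoint)
     (auto simp: finite_polyomino card_cartesian_product dest: polyomino_less_length)

lemma polyomino_last_column:
  assumes "w \<noteq> []"
  shows "(int (length w) - 1, h) \<in> polyomino w \<longleftrightarrow> 0 \<le> h \<and> h < int (last w)"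
proof -
  obtain u i where "w = u @ [i]"
    using assms by (metis append_butlast_last_id)
  then show ?thesis
    by (auto simp: polyomino_snoc dest: polyomino_less_length)
qed

text \<open>
  Left and bottom borders of the old cells stay free, because the new column lies to their
  right.  The new column has one bottom border, and its left borders are those above the
  previous column.  Truncated subtraction counts them: for \<open>j \<le> last w\<close> there are none.
\<close>

lemma sper_snoc:
  assumes "w \<noteq> []" "1 \<le> j"
  shows "sper (w @ [j]) = sper w + 1 + (j - last w)"
proof -
  let ?P = "polyomino w" and ?Q = "polyomino (w @ [j])" and ?n = "int (length w)"
  have less: "k < ?n" if "(k, h) \<in> ?P" for k h
    using that by (rule polyomino_less_length)
  have Q: "(k, h) \<in> ?Q \<longleftrightarrow> (k, h) \<in> ?P \<or> k = ?n \<and> 0 \<le> h \<and> h < int j" for k h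
    by (simp add: polyomino_snoc)
  have "{c \<in> ?Q. c - (1, 0) \<notin> ?Q} =
      {c \<in> ?P. c - (1, 0) \<notin> ?P} \<union> {?n} \<times> {int (last w)..<int j}"
  proof (rule set_eqI)
    fix c :: "int \<times> int"
    obtain k h where c: "c = (k, h)" by (cases c)
    show "c \<in> {c \<in> ?Q. c - (1, 0) \<notin> ?Q} \<longleftrightarrow>
        c \<in> {c \<in> ?P. c - (1, 0) \<notin> ?P} \<union> {?n} \<times> {int (last w)..<int j}"
      using less[of k h] less[of "k - 1" h] polyomino_last_column[OF assms(1), of h]
      by (cases "k = ?n") (auto simp: c Q)
  qed
  then have left: "card {c \<in> ?Q. c - (1, 0) \<notin> ?Q} =
      card {c \<in> ?P. c - (1, 0) \<notin> ?P} + (j - last w)"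
    using finite_polyomino[of w]
    by (simp, subst card_Un_disjoint)
       (auto simp: card_cartesian_product nat_diff_distrib' dest: less)
  have "{c \<in> ?Q. c - (0, 1) \<notin> ?Q} = {c \<in> ?P. c - (0, 1) \<notin> ?P} \<union> {(?n, 0)}"
  proof (rule set_eqI)
    fix c :: "int \<times> int"
    obtain k h where c: "c = (k, h)" by (cases c)
    show "c \<in> {c \<in> ?Q. c - (0, 1) \<notin> ?Q} \<longleftrightarrow>
        c \<in> {c \<in> ?P. c - (0, 1) \<notin> ?P} \<union> {(?n, 0)}"
      using less[of k h] less[of k "h - 1"] assms(2)
      by (cases "k = ?n") (auto simp: c Q)
  qed
  then have bottom: "card {c \<in> ?Q. c - (0, 1) \<notin> ?Q} =
      card {c \<in> ?P. c - (0, 1) \<notin> ?P} + 1"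
    using finite_polyomino[of w] less[of ?n 0]
    by (simp only:, subst card_Un_disjoint) auto
  show ?thesis
    by (simp add: sper_def perimeter_eq_left_bottom finite_polyomino left bottom)
qed

lemma area_singleton: "area [1] = 1"
  using area_snoc[of "[]" 1] by (simp add: area_def polyomino_def)

lemma sper_singleton: "sper [1] = 2"
proof -
  have P: "polyomino [1] = {0}"
    by (auto simp: polyomino_def zero_prod_def)
  have free: "{c \<in> polyomino [1]. c - e \<notin> polyomino [1]} = {0}" if "e \<noteq> 0" for e
    unfolding P using that by auto
  have ne: "(1, 0) \<noteq> (0 :: int \<times> int)" "(0, 1) \<noteq> (0 :: int \<times> int)"
    by (simp_all add: zero_prod_def)
  show ?thesis
    unfolding sper_def perimeter_eq_left_bottom[OF finite_polyomino]
      free[OF ne(1)] free[OF ne(2)] by simp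
qed

section \<open>Generation of Motzkin words\<close>

lemma motzkin_word_singleton: "motzkin_word [j] \<longleftrightarrow> j = 1"
  by (auto simp: motzkin_word_def)

lemma motzkin_word_snoc:
  assumes "w \<noteq> []"
  shows "motzkin_word (w @ [j]) \<longleftrightarrow>
    motzkin_word w \<and> 1 \<le> j \<and> j \<le> last w + 1 \<and> last w \<noteq> j"
proof -
  define R where "R u k \<longleftrightarrow> 1 \<le> u ! k \<and> u ! k \<le> u ! (k - 1) + 1 \<and> u ! (k - 1) \<noteq> u ! k"
    for u :: "nat list" and k
  have len: "1 \<le> length w" using assms by (simp add: Suc_leI)
  have last: "R (w @ [j]) (length w) \<longleftrightarrow> 1 \<le> j \<and> j \<le> last w + 1 \<and> last w \<noteq> j"
    using assms by (simp add: R_def nth_append last_conv_nth)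
  have inner: "R (w @ [j]) k \<longleftrightarrow> R w k" if "k < length w" for k
    using that by (simp add: R_def nth_append less_imp_diff_less)
  have split: "(\<forall>k. 1 \<le> k \<and> k < Suc (length w) \<longrightarrow> S k) \<longleftrightarrow>
      (\<forall>k. 1 \<le> k \<and> k < length w \<longrightarrow> S k) \<and> S (length w)" for S
    using len by (metis less_Suc_eq)
  have mw: "motzkin_word u \<longleftrightarrow>
      1 \<le> length u \<and> u ! 0 = 1 \<and> (\<forall>k. 1 \<le> k \<and> k < length u \<longrightarrow> R u k)" for u
    by (simp only: motzkin_word_def R_def)
  have "(\<forall>k. 1 \<le> k \<and> k < length w \<longrightarrow> R (w @ [j]) k) \<longleftrightarrow>
      (\<forall>k. 1 \<le> k \<and> k < length w \<longrightarrow> R w k)"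
    using inner by metis
  moreover have "(w @ [j]) ! 0 = w ! 0" "1 \<le> Suc (length w)"
    using assms by (simp_all add: nth_append)
  ultimately show ?thesis
    by (simp only: mw length_append_singleton split last len simp_thms conj_assoc)
qed

definition motzkin_words_length :: "nat \<Rightarrow> nat list set" where
  "motzkin_words_length n = {w. motzkin_word w \<and> length w = n}"

lemma motzkin_words_length_0: "motzkin_words_length 0 = {}"
  by (auto simp: motzkin_words_length_def motzkin_word_def)

lemma motzkin_words_length_1: "motzkin_words_length (Suc 0) = {[1]}"
  by (auto simp: motzkin_words_length_def length_Suc_conv motzkin_word_singleton)

lemma motzkin_words_length_Suc:
  assumes "n \<ge> 1"
  shows "motzkin_words_length (Suc n) =
    (\<lambda>(w, j). w @ [j]) `
      (SIGMA w:motzkin_words_length n. insert (last w + 1) {1..<last w})"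
    (is "_ = ?f ` ?S")
proof (intro set_eqI iffI)
  fix u
  assume u: "u \<in> motzkin_words_length (Suc n)"
  then obtain w j where wj: "u = w @ [j]" "length w = n"
    by (auto simp: motzkin_words_length_def length_Suc_conv_rev)
  then have "w \<noteq> []" using assms by auto
  with u wj have "(w, j) \<in> ?S"
    by (auto simp: motzkin_words_length_def motzkin_word_snoc)
  with wj show "u \<in> ?f ` ?S" by force
next
  fix u
  assume "u \<in> ?f ` ?S"
  then obtain w j where wj: "u = w @ [j]" "(w, j) \<in> ?S" by auto
  then have "w \<noteq> []" using assms by (auto simp: motzkin_words_length_def)
  with wj show "u \<in> motzkin_words_length (Suc n)"
    by (auto simp: motzkin_words_length_def motzkin_word_snoc)
qed

lemma finite_motzkin_words_length: "finite (motzkin_words_length n)"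
proof (induction n)
  case (Suc n)
  then show ?case
    by (cases "n \<ge> 1")
       (auto simp: motzkin_words_length_Suc motzkin_words_length_1 not_le
             intro!: finite_imageI finite_SigmaI)
qed (simp add: motzkin_words_length_0)

lemma sum_motzkin_words_length_Suc:
  fixes f :: "nat list \<Rightarrow> 'a::comm_monoid_add"
  assumes "n \<ge> 1"
  shows "(\<Sum>u\<in>motzkin_words_length (Suc n). f u) =
    (\<Sum>w\<in>motzkin_words_length n. f (w @ [last w + 1]) + (\<Sum>j\<in>{1..<last w}. f (w @ [j])))"
proof -
  have inj: "inj_on (\<lambda>(w, j). w @ [j]) S" for S :: "(nat list \<times> nat) set"
    by (auto simp: inj_on_def)
  have "(\<Sum>u\<in>motzkin_words_length (Suc n). f u) =
      (\<Sum>(w, j)\<in>(SIGMA w:motzkin_words_length n. insert (last w + 1) {1..<last w}).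
        f (w @ [j]))"
    unfolding motzkin_words_length_Suc[OF assms] sum.reindex[OF inj]
    by (simp add: case_prod_unfold)
  also have "\<dots> = (\<Sum>w\<in>motzkin_words_length n.
      \<Sum>j\<in>insert (last w + 1) {1..<last w}. f (w @ [j]))"
    by (subst sum.Sigma) (auto simp: finite_motzkin_words_length)
  finally show ?thesis by simp
qed

lemma motzkin_word_nonempty: "motzkin_word w \<Longrightarrow> w \<noteq> []"
  by (auto simp: motzkin_word_def)

lemma motzkin_word_last_ge_1:
  assumes "motzkin_word w"
  shows "1 \<le> last w"
proof -
  have "w \<noteq> []" using assms by (rule motzkin_word_nonempty)
  then obtain u i where w: "w = u @ [i]"
    by (metis append_butlast_last_id)
  then show ?thesis
    using assms by (cases "u = []") (auto simp: motzkin_word_singleton motzkin_word_snoc)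
qed

section \<open>Coefficients of the infinite sums\<close>

lemma fps_nth_suminf:
  fixes f :: "nat \<Rightarrow> 'a::comm_ring_1 fps"
  assumes "\<And>i n. n < i \<Longrightarrow> fps_nth (f i) n = 0"
  shows "fps_nth (suminf f) n = (\<Sum>i\<le>n. fps_nth (f i) n)"
proof -
  have "(\<lambda>N. \<Sum>i<N. f i) \<longlonglongrightarrow> suminf f"
    using summable_fpsI[OF assms] by (simp add: summable_LIMSEQ)
  then have "\<forall>\<^sub>F N in sequentially. fps_nth (\<Sum>i<N. f i) n = fps_nth (suminf f) n"
    by (simp add: tendsto_fps_iff)
  then obtain N where N: "N > n" "fps_nth (\<Sum>i<N. f i) n = fps_nth (suminf f) n"
    using eventually_happens[OF eventually_conj[OF _ eventually_gt_at_top[of n]]] by force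
  have "(\<Sum>i<N. fps_nth (f i) n) = (\<Sum>i\<le>n. fps_nth (f i) n)"
    by (rule sum.mono_neutral_right) (use N(1) assms in auto)
  with N(2) show ?thesis by (simp add: fps_sum_nth)
qed

text \<open>
  Up to order \<open>n\<close> the series agrees with its partial sum of the powers \<open>u ^ k\<close> with
  \<open>k \<le> n\<close>, and for that sum the product telescopes to \<open>1 - u ^ Suc n\<close>.
\<close>

lemma geometric_series_mult:
  fixes u :: "'a::comm_ring_1 fps"
  assumes "fps_nth u 0 = 0"
  shows "geometric_series u * (1 - u) = 1"
proof (rule fps_ext)
  fix n
  have zero: "fps_nth (u ^ k) m = 0" if "m < k" for k m
    using that assms by (simp add: startsby_zero_power_prefix)
  have trunc: "fps_nth (geometric_series u) m = fps_nth (\<Sum>k\<le>n. u ^ k) m" if "m \<le> n" for m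
  proof -
    have "(\<Sum>k\<le>m. fps_nth (u ^ k) m) = (\<Sum>k\<le>n. fps_nth (u ^ k) m)"
      by (rule sum.mono_neutral_left) (use that zero in auto)
    then show ?thesis
      unfolding geometric_series_def by (simp add: fps_nth_suminf zero fps_sum_nth)
  qed
  have "fps_nth (geometric_series u * (1 - u)) n = fps_nth ((\<Sum>k\<le>n. u ^ k) * (1 - u)) n"
    unfolding fps_mult_nth by (rule sum.cong) (auto simp: trunc)
  also have "(\<Sum>k\<le>n. u ^ k) * (1 - u) = 1 - u ^ Suc n"
    by (metis mult.commute one_diff_power_eq' lessThan_Suc_atMost one_diff_power_eq)
  also have "fps_nth (1 - u ^ Suc n) n = fps_nth 1 n"
    using zero[of n "Suc n"] by simp
  finally show "fps_nth (geometric_series u * (1 - u)) n = fps_nth 1 n" .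
qed

text \<open>
  Words of length \<open>n\<close> have last letters at most \<open>n\<close>, so the sum over \<open>i\<close> is finite in each
  coefficient, and grouping by the last letter merges it with the sum over words.
\<close>

lemma fps_nth_A:
  "fps_nth (A p q v) n =
    (\<Sum>w\<in>motzkin_words_length n. p ^ sper w * q ^ area w * v ^ (last w - 1))"
proof -
  let ?f = "\<lambda>w. p ^ sper w * q ^ area w * v ^ (last w - 1)"
  have fibre: "{w \<in> motzkin_words_length n. last w - 1 = i} = motzkin_words n (Suc i)" for i
    by (auto simp: motzkin_words_length_def motzkin_words_def dest: motzkin_word_last_ge_1)
  have range: "(\<lambda>w. last w - 1) ` motzkin_words_length n \<subseteq> {..n}"
  proof safe
    fix w
    assume "w \<in> motzkin_words_length n"
    then have "motzkin_words n (last w) \<noteq> {}"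
      by (auto simp: motzkin_words_length_def motzkin_words_def)
    then have "last w \<le> n"
      using motzkin_words_empty[of n "last w"] by (cases "last w \<le> n") auto
    then show "last w - 1 \<le> n" by simp
  qed
  have "fps_nth (A p q v) n =
      (\<Sum>i\<le>n. fps_nth (A_coeff p q (Suc i) * fps_const (v ^ i)) n)"
    unfolding A_def by (rule fps_nth_suminf) (simp add: A_coeff_def motzkin_words_empty)
  also have "\<dots> = (\<Sum>i\<le>n. \<Sum>w\<in>motzkin_words n (Suc i). ?f w)"
    by (auto simp: A_coeff_def sum_distrib_right motzkin_words_def intro!: sum.cong)
  also have "\<dots> = (\<Sum>w\<in>motzkin_words_length n. ?f w)"
    using sum.group[OF finite_motzkin_words_length finite_atMost range, of ?f]
    by (simp only: fibre)
  finally show ?thesis .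
qed

section \<open>The functional equation\<close>

text \<open>
  The inner sum is geometric with ratio \<open>q * v\<close>, and multiplication by the inverse \<open>g\<close> of
  \<open>1 - q * v\<close> evaluates it without any division in the ring.
\<close>

lemma weight_extensions:
  fixes p q v g :: "'a::comm_ring_1"
  assumes g: "g * (1 - q * v) = 1" and w: "motzkin_word w"
  defines "f \<equiv> \<lambda>u. p ^ sper u * q ^ area u * v ^ (last u - 1)"
  shows "f (w @ [last w + 1]) + (\<Sum>j\<in>{1..<last w}. f (w @ [j])) =
    p ^ sper w * q ^ area w *
      (p * q * g + (p\<^sup>2 * q\<^sup>2 * v - p * q * g) * (q * v) ^ (last w - 1))"
proof -
  have ne: "w \<noteq> []" using w by (rule motzkin_word_nonempty)
  obtain m where m: "last w = Suc m"
    using motzkin_word_last_ge_1[OF w] by (cases "last w") auto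
  have up: "f (w @ [last w + 1]) =
      p ^ sper w * q ^ area w * (p\<^sup>2 * q\<^sup>2 * v * (q * v) ^ m)"
    using ne by (simp add: f_def sper_snoc area_snoc m power_add power2_eq_square
        power_mult_distrib algebra_simps)
  have "(\<Sum>j\<in>{1..<last w}. f (w @ [j])) = (\<Sum>j<m. f (w @ [Suc j]))"
    by (rule sum.reindex_bij_witness[of _ Suc "\<lambda>j. j - 1"]) (auto simp: m)
  also have "\<dots> = (\<Sum>j<m. p ^ sper w * q ^ area w * (p * q) * (q * v) ^ j)"
    using ne by (intro sum.cong) (auto simp: f_def sper_snoc area_snoc m power_add
        power_mult_distrib algebra_simps)
  also have "\<dots> = p ^ sper w * q ^ area w * (p * q * (\<Sum>j<m. (q * v) ^ j))"
    by (simp add: sum_distrib_left mult.assoc)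
  also have "(\<Sum>j<m. (q * v) ^ j) = g * (1 - q * v) * (\<Sum>j<m. (q * v) ^ j)"
    by (simp add: g)
  also have "\<dots> = g * (1 - (q * v) ^ m)"
    by (simp add: one_diff_power_eq mult.assoc)
  finally have down: "(\<Sum>j\<in>{1..<last w}. f (w @ [j])) =
      p ^ sper w * q ^ area w * (p * q * (g * (1 - (q * v) ^ m)))" .
  show ?thesis
    unfolding up down by (simp add: m algebra_simps)
qed

text \<open>
  The factor \<open>1 / (1 - q * v)\<close> enters only through the geometric sums over the descents, as
  an inverse \<open>g\<close> of \<open>1 - q * v\<close>; for power series in \<open>v\<close> this inverse is the geometric
  series.  Comparing coefficients of \<open>x\<close> keeps all sums finite: the coefficient of
  \<open>x ^ Suc n\<close> on the left is determined by the words of length \<open>n\<close>, whose sums appear on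
  the right after multiplication by \<open>x\<close>.
\<close>

lemma A_functional_equation:
  fixes p q v g :: "'a::comm_ring_1"
  assumes g: "g * (1 - q * v) = 1"
  shows "A p q v =
      fps_const (p\<^sup>2 * q) * fps_X
    + fps_const (p * q * g) * fps_X * A p q 1
    + (fps_const (p\<^sup>2 * q\<^sup>2 * v) * fps_X - fps_const (p * q * g) * fps_X) * A p q (q * v)"
    (is "_ = ?R")
proof (rule fps_ext)
  fix n
  have shift: "fps_nth (fps_const c * fps_X * F) m = (if m = 0 then 0 else c * fps_nth F (m - 1))"
    for c :: 'a and F m
    by (simp add: mult.assoc)
  have R: "fps_nth ?R m = (if m = 0 then 0 else
      (if m = 1 then p\<^sup>2 * q else 0) + p * q * g * fps_nth (A p q 1) (m - 1)
      + (p\<^sup>2 * q\<^sup>2 * v - p * q * g) * fps_nth (A p q (q * v)) (m - 1))" for m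
    by (simp add: left_diff_distrib shift del: fps_const_mult)
  show "fps_nth (A p q v) n = fps_nth ?R n"
  proof (cases n)
    case 0
    then show ?thesis
      unfolding R by (simp add: fps_nth_A motzkin_words_length_0)
  next
    case (Suc m)
    show ?thesis
    proof (cases "m = 0")
      case True
      then show ?thesis
        using Suc sper_singleton area_singleton
        unfolding R by (simp add: fps_nth_A motzkin_words_length_0 motzkin_words_length_1)
    next
      case False
      let ?f = "\<lambda>u. p ^ sper u * q ^ area u * v ^ (last u - 1)"
      let ?h = "p\<^sup>2 * q\<^sup>2 * v - p * q * g"
      have "fps_nth (A p q v) n = (\<Sum>w\<in>motzkin_words_length m.
          ?f (w @ [last w + 1]) + (\<Sum>j\<in>{1..<last w}. ?f (w @ [j])))"
        using False unfolding Suc fps_nth_A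
        by (intro sum_motzkin_words_length_Suc) simp
      also have "\<dots> = (\<Sum>w\<in>motzkin_words_length m.
          p ^ sper w * q ^ area w * (p * q * g + ?h * (q * v) ^ (last w - 1)))"
        by (intro sum.cong refl weight_extensions[OF g])
           (simp add: motzkin_words_length_def)
      also have "\<dots> = p * q * g * fps_nth (A p q 1) m + ?h * fps_nth (A p q (q * v)) m"
        unfolding fps_nth_A sum_distrib_left sum.distrib[symmetric]
        by (intro sum.cong) (simp_all only: distrib_left power_one mult_1_left mult_1_right mult_ac)
      finally show ?thesis
        unfolding R using False Suc by simp
    qed
  qed
qed

theorem theorem3p1:
  fixes p q v :: "int poly poly fps" and x :: "int poly poly fps fps"
  defines "p \<equiv> indet_p" and "q \<equiv> indet_q" and "v \<equiv> indet_v" and "x \<equiv> fps_X"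
  shows "A p q v =
      fps_const (p ^ 2 * q) * x
    + fps_const (p * q * geometric_series (q * v)) * x * A p q 1
    + (fps_const (p ^ 2 * q ^ 2 * v) * x
        - fps_const (p * q * geometric_series (q * v)) * x) * A p q (q * v)"
proof -
  have "fps_nth (q * v) 0 = 0"
    by (simp add: v_def indet_v_def)
  then show ?thesis
    unfolding x_def by (intro A_functional_equation geometric_series_mult)
qed

end
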